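(* Let $p>0$ be a real number and let $(F,\|\cdot\|)$ be a finite-dimensional real normed space with $\dim F\geq 1$. Then $F$ is isometric to a linear subspace of $\ell_p$ if and only if $F$ has a discrete Levy $p$-representation.
   Context: All vector spaces are over $\mathbb{R}$, and all isometries are linear. $\ell_p$ denotes the space of real sequences $x=(x_j)_{j=1}^\infty$ with $\sum_j|x_j|^p<\infty$, with $\|x\|_p=\left(\sum_j|x_j|^p\right)^{1/p}$. "$F$ is isometric to a subspace of $\ell_p$" means that there is a linear map $T:F\to\ell_p$ with $\|Tx\|_p=\|x\|$ for all $x\in F$. Let $\langle\cdot,\cdot\rangle$ be the standard inner product on $\mathbb{R}^n$, $\|\cdot\|_2$ the Euclidean norm, and $\mathbb{S}^{n-1}=\{u\in\mathbb{R}^n:\|u\|_2=1\}$. A finite-dimensional normed space $(F,\|\cdot\|)$ with $n=\dim F$ has a Levy $p$-representation if there exist a linear isomorphism $J:F\to\mathbb{R}^n$ and an even (positive) measure $\xi$ on $\mathbb{S}^{n-1}$ such that for every $x\in F$ $$\|x\|^p=\int_{\mathbb{S}^{n-1}}|\langle Jx,v\rangle|^p\,d\xi(v).$$ The representation is discrete if there exist a sequence of positive numbers $(a_j)_{j=1}^\infty$ and a sequence of points $(v_j)_{j=1}^\infty$ in $\mathbb{S}^{n-1}$ (not required to be distinct) such that $\xi=\sum_{j=1}^\infty a_j(\delta_{v_j}+\delta_{-v_j})$, where $\delta_v$ is the unit point mass at $v$. $F$ has a discrete Levy $p$-representation if it has some Levy $p$-representation that is discrete. *)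

theory Defs
  imports "HOL-Probability.Probability"
begin

text \<open>The type of real sequences is not a real vector space in the library, so linearity
  of a map into it is spelled out with pointwise operations.\<close>

definition lp_space :: "real \<Rightarrow> (nat \<Rightarrow> real) set" where
  "lp_space p = {x. summable (\<lambda>j. \<bar>x j\<bar> powr p)}"

definition lp_norm :: "real \<Rightarrow> (nat \<Rightarrow> real) \<Rightarrow> real" where
  "lp_norm p x = (\<Sum>j. \<bar>x j\<bar> powr p) powr (1 / p)"

definition linear_isometry_into_lp ::
    "real \<Rightarrow> ('a::real_normed_vector \<Rightarrow> nat \<Rightarrow> real) \<Rightarrow> bool" where
  "linear_isometry_into_lp p T \<longleftrightarrow>
     (\<forall>x. T x \<in> lp_space p) \<and>
     (\<forall>x y. T (x + y) = (\<lambda>j. T x j + T y j)) \<and>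
     (\<forall>c x. T (c *\<^sub>R x) = (\<lambda>j. c * T x j)) \<and>
     (\<forall>x. lp_norm p (T x) = norm x)"

definition sphere_borel :: "(real ^ 'n) measure" where
  "sphere_borel = restrict_space borel (sphere 0 1)"

definition even_measure :: "(real ^ 'n) measure \<Rightarrow> bool" where
  "even_measure \<xi> \<longleftrightarrow> (\<forall>A\<in>sets \<xi>. emeasure \<xi> (uminus ` A) = emeasure \<xi> A)"

text \<open>The integral is taken in the extended nonnegative reals, so the defining equation
  includes its finiteness. No finiteness of the measure is assumed.\<close>

definition levy_representation ::
    "real \<Rightarrow> ('a::real_normed_vector \<Rightarrow> real ^ 'n) \<Rightarrow> (real ^ 'n) measure \<Rightarrow> bool" where
  "levy_representation p J \<xi> \<longleftrightarrow>
     linear J \<and> bij J \<and>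
     sets \<xi> = sets sphere_borel \<and> even_measure \<xi> \<and>
     (\<forall>x. ennreal (norm x powr p) = (\<integral>\<^sup>+ v. ennreal (\<bar>J x \<bullet> v\<bar> powr p) \<partial>\<xi>))"

text \<open>\<open>return sphere_borel v\<close> is the unit point mass at \<open>v\<close>.
  The library has no sum of measures, so the equality of measures is stated setwise.\<close>

definition discrete_measure :: "(real ^ 'n) measure \<Rightarrow> bool" where
  "discrete_measure \<xi> \<longleftrightarrow>
     (\<exists>(a :: nat \<Rightarrow> real) (v :: nat \<Rightarrow> real ^ 'n).
        (\<forall>j. a j > 0) \<and> (\<forall>j. v j \<in> sphere 0 1) \<and>
        (\<forall>A\<in>sets sphere_borel. emeasure \<xi> A =
           (\<Sum>j. ennreal (a j) *
              (emeasure (return sphere_borel (v j)) A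
                + emeasure (return sphere_borel (- v j)) A))))"

definition isometric_to_subspace_of_lp :: "real \<Rightarrow> 'a::real_normed_vector itself \<Rightarrow> bool" where
  "isometric_to_subspace_of_lp p F \<longleftrightarrow>
     (\<exists>T :: 'a \<Rightarrow> nat \<Rightarrow> real. linear_isometry_into_lp p T)"

text \<open>The second type argument is the index type of the coordinate space; for it to be
  \<open>\<real>\<^sup>n\<close> with \<open>n\<close> the dimension of the space, its cardinality must be that dimension.\<close>

definition has_discrete_levy_representation ::
    "real \<Rightarrow> 'a::real_normed_vector itself \<Rightarrow> 'n::finite itself \<Rightarrow> bool" where
  "has_discrete_levy_representation p F N \<longleftrightarrow>
     (\<exists>(J :: 'a \<Rightarrow> real ^ 'n) \<xi>. levy_representation p J \<xi> \<and> discrete_measure \<xi>)"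

end

(* A linear functional on F is x |-> <J x, w> for some w, and a nonzero w is its length times a
   point of the sphere, so an isometry into l_p amounts to a discrete measure whose weights are
   the |w_j|^p / 2. Zero functionals have no direction; since the weights of a discrete
   representation must all be positive, the mass of one nonzero functional is spread
   geometrically over the indices of the zero ones. *)
theory Submission
  imports Defs
begin

section \<open>Linear coordinates on a finite-dimensional space\<close>

text \<open>Two bases of equal cardinality are matched by a bijection; extending it and its inverse
  linearly gives maps whose composites fix a basis and hence are identities.\<close>

lemma linear_bij_of_dim_eq:
  assumes "dim (UNIV :: 'a::real_normed_vector set) \<ge> 1"
    and "DIM('b::euclidean_space) = dim (UNIV :: 'a set)"
  obtains J :: "'a::real_normed_vector \<Rightarrow> 'b::euclidean_space" and K :: "'b \<Rightarrow> 'a"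
  where "linear J" "linear K" "\<And>x. K (J x) = x" "\<And>y. J (K y) = y"
proof -
  obtain B :: "'a set" where B: "independent B" "UNIV \<subseteq> span B" "card B = dim (UNIV :: 'a set)"
    using basis_exists by blast
  \<comment> \<open>An infinite set has \<open>card\<close> 0, so positive dimension forces
    \<open>B\<close> to be finite.\<close>
  have "finite B"
    using B(3) assms(1) by (metis card.infinite not_one_le_zero)
  then obtain f where f: "bij_betw f B (Basis :: 'b set)"
    using B(3) assms(2) finite_same_card_bij by (metis finite_Basis)
  obtain J :: "'a \<Rightarrow> 'b" where J: "linear J" "\<And>x. x \<in> B \<Longrightarrow> J x = f x"
    using linear_independent_extend[OF B(1), of f] by blast
  obtain K :: "'b \<Rightarrow> 'a" where K: "linear K" "\<And>y. y \<in> Basis \<Longrightarrow> K y = inv_into B f y"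
    using linear_independent_extend[OF independent_Basis, of "inv_into B f"] by blast
  have fB: "f x \<in> Basis" "inv_into B f (f x) = x" if "x \<in> B" for x
    using f that by (auto simp: bij_betw_def)
  have fBasis: "inv_into B f y \<in> B" "f (inv_into B f y) = y" if "y \<in> Basis" for y
    using f that by (auto simp: bij_betw_def inv_into_into f_inv_into_f)
  have "(K \<circ> J) x = id x" for x
    by (rule linear_eq_on_span[OF linear_compose[OF J(1) K(1)] linear_id, of B])
      (use B(2) in \<open>auto simp: J(2) K(2) fB\<close>)
  moreover have "(J \<circ> K) y = id y" for y
    by (rule linear_eq_on_span[OF linear_compose[OF K(1) J(1)] linear_id, of Basis])
      (auto simp: J(2) K(2) fBasis)
  ultimately show thesis
    using that J(1) K(1) by simp
qed

section \<open>The sphere and its antipodal map\<close>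

lemma space_sphere_borel [simp]: "space sphere_borel = sphere 0 1"
  by (simp add: sphere_borel_def space_restrict_space)

lemma uminus_measurable_sphere_borel [measurable]:
  "uminus \<in> sphere_borel \<rightarrow>\<^sub>M (sphere_borel :: (real ^ 'n) measure)"
  unfolding sphere_borel_def
  by (intro measurable_restrict_space3) auto

lemma mem_uminus_image_iff: "u \<in> uminus ` A \<longleftrightarrow> - u \<in> A" for u :: "'a::group_add"
  by (metis image_iff minus_minus)

text \<open>Negation is an involution, so the image is a preimage under a measurable map. Evenness
  thus compares measures of measurable sets only.\<close>

lemma uminus_image_sets_sphere_borel:
  assumes "A \<in> sets (sphere_borel :: (real ^ 'n) measure)"
  shows "uminus ` A \<in> sets sphere_borel"
proof -
  have "A \<subseteq> sphere 0 1"
    using sets.sets_into_space[OF assms] by simp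
  then have "uminus ` A = uminus -` A \<inter> space sphere_borel"
    by (auto simp: mem_uminus_image_iff)
  then show ?thesis
    using measurable_sets[OF uminus_measurable_sphere_borel assms] by simp
qed

section \<open>Sums of symmetric pairs of point masses\<close>

text \<open>The sum of the point masses at \<open>v j\<close> and \<open>- v j\<close> with weight
  \<open>a j\<close>. As the image of a weighted counting measure on pairs of an index and a sign,
  it is countably additive by construction.\<close>

definition symmetric_atoms :: "(nat \<Rightarrow> real) \<Rightarrow> (nat \<Rightarrow> real ^ 'n) \<Rightarrow> (real ^ 'n) measure" where
  "symmetric_atoms a v =
     distr (density (count_space (UNIV :: (nat \<times> bool) set)) (\<lambda>(j, b). ennreal (a j)))
       sphere_borel (\<lambda>(j, b). if b then v j else - v j)"

lemma sets_symmetric_atoms [simp, measurable_cong]: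
  "sets (symmetric_atoms a v) = sets sphere_borel"
  by (simp add: symmetric_atoms_def)

text \<open>Pulling the integral back to the index-sign pairs and summing over the sign first turns
  it into a series.\<close>

lemma nn_integral_symmetric_atoms:
  fixes v :: "nat \<Rightarrow> real ^ 'n"
  assumes v: "\<forall>j. v j \<in> sphere 0 1" and f: "f \<in> borel_measurable sphere_borel"
  shows "(\<integral>\<^sup>+ u. f u \<partial>symmetric_atoms a v) = (\<Sum>j. ennreal (a j) * (f (v j) + f (- v j)))"
proof -
  let ?d = "\<lambda>(j, b :: bool). ennreal (a j)"
  let ?g = "\<lambda>(j, b). if b then v j else - v j"
  have g: "?g \<in> density (count_space UNIV) ?d \<rightarrow>\<^sub>M sphere_borel"
    using v by auto
  have "(\<integral>\<^sup>+ u. f u \<partial>symmetric_atoms a v)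
      = (\<integral>\<^sup>+ z. ?d z * f (?g z) \<partial>count_space UNIV)"
    unfolding symmetric_atoms_def by (simp add: nn_integral_distr[OF g] f nn_integral_density)
  also have "\<dots> = (\<integral>\<^sup>+ j. (\<integral>\<^sup>+ b. ?d (j, b) * f (?g (j, b)) \<partial>count_space UNIV) \<partial>count_space UNIV)"
    by (rule nn_integral_fst_count_space[symmetric])
  also have "\<dots> = (\<Sum>j. ennreal (a j) * (f (v j) + f (- v j)))"
    by (simp add: nn_integral_count_space_nat nn_integral_count_space_finite UNIV_bool
        distrib_left add.commute)
  finally show ?thesis .
qed

lemma emeasure_symmetric_atoms:
  fixes v :: "nat \<Rightarrow> real ^ 'n"
  assumes v: "\<forall>j. v j \<in> sphere 0 1" and A: "A \<in> sets sphere_borel"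
  shows "emeasure (symmetric_atoms a v) A =
    (\<Sum>j. ennreal (a j) * (emeasure (return sphere_borel (v j)) A
       + emeasure (return sphere_borel (- v j)) A))"
  using nn_integral_symmetric_atoms[OF v, of "indicator A" a] A by (simp add: emeasure_return)

text \<open>Negation swaps the two equally weighted atoms of each pair.\<close>

lemma even_symmetric_atoms:
  fixes v :: "nat \<Rightarrow> real ^ 'n"
  assumes v: "\<forall>j. v j \<in> sphere 0 1"
  shows "even_measure (symmetric_atoms a v)"
  unfolding even_measure_def
proof
  fix A assume "A \<in> sets (symmetric_atoms a v)"
  then have A: "A \<in> sets sphere_borel"
    by simp
  have "indicator (uminus ` A) u = (indicator A (- u) :: ennreal)" for u
    by (simp add: indicator_def mem_uminus_image_iff)
  then show "emeasure (symmetric_atoms a v) (uminus ` A) = emeasure (symmetric_atoms a v) A"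
    using A uminus_image_sets_sphere_borel[OF A]
    by (simp add: emeasure_symmetric_atoms[OF v] emeasure_return add.commute)
qed

text \<open>Measures with the same measurable sets and the same values on them are equal. This
  replaces the setwise condition by a concrete measure whose integrals are known series.\<close>

lemma discrete_measure_iff:
  fixes \<xi> :: "(real ^ 'n) measure"
  assumes "sets \<xi> = sets sphere_borel"
  shows "discrete_measure \<xi> \<longleftrightarrow>
    (\<exists>a v. (\<forall>j. a j > 0) \<and> (\<forall>j. v j \<in> sphere 0 1) \<and> \<xi> = symmetric_atoms a v)"
proof
  assume "discrete_measure \<xi>"
  then obtain a :: "nat \<Rightarrow> real" and v :: "nat \<Rightarrow> real ^ 'n"
    where a: "\<forall>j. a j > 0" and v: "\<forall>j. v j \<in> sphere 0 1"
      and \<xi>: "\<forall>A\<in>sets sphere_borel. emeasure \<xi> A = (\<Sum>j. ennreal (a j) *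
         (emeasure (return sphere_borel (v j)) A + emeasure (return sphere_borel (- v j)) A))"
    unfolding discrete_measure_def by blast
  have "\<xi> = symmetric_atoms a v"
    by (rule measure_eqI) (use assms \<xi> v in \<open>auto simp: emeasure_symmetric_atoms\<close>)
  then show "\<exists>a v. (\<forall>j. a j > 0) \<and> (\<forall>j. v j \<in> sphere 0 1) \<and> \<xi> = symmetric_atoms a v"
    using a v by blast
next
  assume "\<exists>a v. (\<forall>j. a j > 0) \<and> (\<forall>j. v j \<in> sphere 0 1) \<and> \<xi> = symmetric_atoms a v"
  then show "discrete_measure \<xi>"
    unfolding discrete_measure_def using emeasure_symmetric_atoms by blast
qed

text \<open>The integrand is even, so both atoms of a pair contribute the same amount; hence the
  factor 2.\<close>

lemma nn_integral_inner_symmetric_atoms: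
  fixes v :: "nat \<Rightarrow> real ^ 'n"
  assumes v: "\<forall>j. v j \<in> sphere 0 1" and a: "\<forall>j. a j \<ge> 0"
  shows "(\<integral>\<^sup>+ u. ennreal (\<bar>y \<bullet> u\<bar> powr p) \<partial>symmetric_atoms a v)
    = (\<Sum>j. ennreal (2 * a j * \<bar>y \<bullet> v j\<bar> powr p))"
proof -
  have "(\<lambda>u. ennreal (\<bar>y \<bullet> u\<bar> powr p)) \<in> borel_measurable sphere_borel"
    unfolding sphere_borel_def by (intro measurable_restrict_space1) measurable
  moreover have "ennreal (a j) * (ennreal r + ennreal r) = ennreal (2 * a j * r)"
    if "r \<ge> 0" for j r
    using that a by (simp flip: ennreal_plus ennreal_mult'' add: algebra_simps)
  ultimately show ?thesis
    by (simp add: nn_integral_symmetric_atoms[OF v])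
qed

section \<open>From a discrete representation to an isometry\<close>

text \<open>The factor \<open>(2 * a j) powr (1 / p)\<close> is chosen so that its
  \<open>p\<close>-th power is the weight \<open>2 * a j\<close> of the pair.\<close>

lemma lp_isometry_of_symmetric_atoms:
  fixes J :: "'a::real_normed_vector \<Rightarrow> real ^ 'n"
  assumes p: "p > 0" and a: "\<forall>j. a j > 0" and v: "\<forall>j. v j \<in> sphere 0 1"
    and levy: "levy_representation p J (symmetric_atoms a v)"
  shows "linear_isometry_into_lp p (\<lambda>x j. (2 * a j) powr (1 / p) * (J x \<bullet> v j))"
proof -
  let ?T = "\<lambda>x j. (2 * a j) powr (1 / p) * (J x \<bullet> v j)"
  have J: "linear J"
    using levy by (simp add: levy_representation_def)
  have a': "\<forall>j. a j \<ge> 0"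
    using a less_imp_le by blast
  have T: "\<bar>?T x j\<bar> powr p = 2 * a j * \<bar>J x \<bullet> v j\<bar> powr p" for x j
    using p a[rule_format, of j] by (simp add: abs_mult powr_mult powr_powr)
  have "(\<lambda>j. \<bar>?T x j\<bar> powr p) sums (norm x powr p)" for x
  proof -
    have "ennreal (norm x powr p) = (\<integral>\<^sup>+ u. ennreal (\<bar>J x \<bullet> u\<bar> powr p) \<partial>symmetric_atoms a v)"
      using levy unfolding levy_representation_def by blast
    also have "\<dots> = (\<Sum>j. ennreal (\<bar>?T x j\<bar> powr p))"
      unfolding T by (rule nn_integral_inner_symmetric_atoms[OF v a'])
    finally have "(\<lambda>j. ennreal (\<bar>?T x j\<bar> powr p)) sums ennreal (norm x powr p)"
      using summable_sums[OF summableI] by simp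
    \<comment> \<open>The extended series has a finite limit, so the real series converges; this
      yields both membership in \<open>lp_space p\<close> and the norm.\<close>
    then show ?thesis
      by (simp only: sums_ennreal powr_ge_zero)
  qed
  note sums = this
  have "lp_norm p (?T x) = norm x" for x
    unfolding lp_norm_def sums_unique[OF sums, symmetric] using p by (simp add: powr_powr)
  moreover have "?T x \<in> lp_space p" for x
    using sums[of x] by (auto simp: lp_space_def sums_iff)
  ultimately show ?thesis
    unfolding linear_isometry_into_lp_def
    by (simp add: linear_add[OF J] linear_scale[OF J] inner_add_left algebra_simps)
qed

section \<open>From an isometry to a discrete representation\<close>

lemma lp_isometry_sums:
  assumes p: "p > 0" and T: "linear_isometry_into_lp p T"
  shows "(\<lambda>j. \<bar>T x j\<bar> powr p) sums (norm x powr p)"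
proof -
  have s: "summable (\<lambda>j. \<bar>T x j\<bar> powr p)"
    and n: "(\<Sum>j. \<bar>T x j\<bar> powr p) powr (1 / p) = norm x"
    using T by (auto simp: linear_isometry_into_lp_def lp_space_def lp_norm_def)
  have "norm x powr p = (\<Sum>j. \<bar>T x j\<bar> powr p)"
    unfolding n[symmetric] using p suminf_nonneg[OF s] by (simp add: powr_powr)
  then show ?thesis
    using s by (simp add: sums_iff)
qed

lemma symmetric_atoms_of_functionals:
  fixes w :: "nat \<Rightarrow> real ^ 'n"
  assumes p: "p > 0" and k: "w k \<noteq> 0"
  obtains a v where "\<forall>j. a j > 0" "\<forall>j. v j \<in> sphere 0 1"
    "\<And>y s. (\<lambda>j. \<bar>y \<bullet> w j\<bar> powr p) sums s \<Longrightarrow> (\<lambda>j. 2 * a j * \<bar>y \<bullet> v j\<bar> powr p) sums s"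
proof -
  \<comment> \<open>The indices that share the mass of \<open>w k\<close>. As \<open>k\<close>
    itself belongs to \<open>Z\<close>, it keeps all of that mass when no \<open>w j\<close>
    vanishes.\<close>
  define Z where "Z = insert k {j. w j = 0}"
  define q :: "nat \<Rightarrow> real" where "q j = (if j \<in> Z then (1 / 2) ^ j else 0)" for j
  have q: "summable q"
    by (rule summable_comparison_test'[of "\<lambda>j. (1 / 2) ^ j"]) (auto simp: q_def summable_geometric)
  have "q k > 0"
    by (simp add: q_def Z_def)
  then have S: "suminf q > 0"
    using q by (intro suminf_pos2[of _ k]) (auto simp: q_def)
  define m where "m j = (if j \<in> Z then k else j)" for j
  \<comment> \<open>The shares \<open>q j / suminf q\<close> are positive on \<open>Z\<close> and
    add up to 1. Halving compensates for the two atoms of each pair.\<close>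
  define a where "a j = (if j \<in> Z then q j / suminf q else 1) * norm (w (m j)) powr p / 2" for j
  define v where "v j = w (m j) /\<^sub>R norm (w (m j))" for j
  have m: "w (m j) \<noteq> 0" for j
    using k by (auto simp: m_def Z_def)
  show thesis
  proof
    show "\<forall>j. a j > 0"
      using S m by (auto simp: a_def q_def)
    show "\<forall>j. v j \<in> sphere 0 1"
      using m by (simp add: v_def)
  next
    fix y s
    let ?f = "\<lambda>j. \<bar>y \<bullet> w j\<bar> powr p"
    assume f: "?f sums s"
    have scale: "norm (w (m j)) powr p * \<bar>y \<bullet> v j\<bar> powr p = ?f (m j)" for j
      using m[of j] by (simp add: v_def abs_mult flip: powr_mult mult.assoc)
    have "(\<lambda>j. q j / suminf q * ?f k) sums (suminf q / suminf q * ?f k)"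
      by (intro sums_mult2 sums_divide summable_sums q)
    \<comment> \<open>The term at \<open>k\<close> is removed and handed out again in shares, which
      leaves the sum unchanged. On the rest of \<open>Z\<close> the original terms are 0.\<close>
    then have "(\<lambda>j. ?f j - (if j = k then ?f j else 0) + q j / suminf q * ?f k) sums
        (s - ?f k + ?f k)"
      using S f by (intro sums_add sums_diff sums_single) auto
    moreover have "?f j - (if j = k then ?f j else 0) + q j / suminf q * ?f k
        = 2 * a j * \<bar>y \<bullet> v j\<bar> powr p" for j
    proof (cases "j \<in> Z")
      case True
      then have "?f j - (if j = k then ?f j else 0) = 0" "m j = k"
        by (auto simp: Z_def m_def)
      then show ?thesis
        using True scale[of j] by (simp add: a_def)
    next
      case False
      then have "j \<noteq> k" "q j = 0" "m j = j"
        by (auto simp: Z_def m_def q_def)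
      then show ?thesis
        using False scale[of j] by (simp add: a_def)
    qed
    ultimately show "(\<lambda>j. 2 * a j * \<bar>y \<bullet> v j\<bar> powr p) sums s"
      by simp
  qed
qed

text \<open>Any linear isomorphism \<open>J\<close> serves: the coordinates of \<open>T\<close>
  become functionals on the Euclidean space, and their representing vectors determine the
  atoms.\<close>

lemma discrete_levy_representation_of_lp_isometry:
  fixes T :: "'a::real_normed_vector \<Rightarrow> nat \<Rightarrow> real"
  assumes p: "p > 0" and T: "linear_isometry_into_lp p T"
    and dim: "dim (UNIV :: 'a set) \<ge> 1" "CARD('n::finite) = dim (UNIV :: 'a set)"
  shows "has_discrete_levy_representation p TYPE('a) TYPE('n)"
proof -
  obtain J :: "'a \<Rightarrow> real ^ 'n" and K
    where J: "linear J" and K: "linear K" and KJ: "\<And>x. K (J x) = x" and JK: "\<And>y. J (K y) = y"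
    using linear_bij_of_dim_eq[where 'a = 'a and 'b = "real ^ 'n"] dim by auto
  \<comment> \<open>The adjoint of a functional, evaluated at 1, is its Riesz vector.\<close>
  define w where "w j = adjoint (\<lambda>y. T (K y) j) 1" for j
  have "linear (\<lambda>y. T (K y) j)" for j
    using T by (intro linearI)
      (simp_all add: linear_isometry_into_lp_def linear_add[OF K] linear_scale[OF K])
  then have w: "J x \<bullet> w j = T x j" for x j
    by (simp add: w_def adjoint_works KJ)
  have sums: "(\<lambda>j. \<bar>J x \<bullet> w j\<bar> powr p) sums (norm x powr p)" for x
    unfolding w by (rule lp_isometry_sums[OF p T])
  \<comment> \<open>If every functional vanished, so would every norm, and the space would have
    dimension 0.\<close>
  obtain k where k: "w k \<noteq> 0"
  proof (rule ccontr)
    assume "\<not> thesis"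
    then have "w k = 0" for k
      using that by blast
    then have "norm x powr p = 0" for x :: 'a
      using sums_unique[OF sums[of x]] p by simp
    then have "x = 0" for x :: 'a
      by simp
    then have "UNIV = {0 :: 'a}"
      by auto
    then have "dim (UNIV :: 'a set) = 0"
      using dim_eq_card[of "{}" "UNIV :: 'a set"] independent_empty by simp
    then show False
      using dim(1) by simp
  qed
  obtain a v where a: "\<forall>j. a j > 0" and v: "\<forall>j. v j \<in> sphere 0 1"
    and av: "\<And>y s. (\<lambda>j. \<bar>y \<bullet> w j\<bar> powr p) sums s \<Longrightarrow> (\<lambda>j. 2 * a j * \<bar>y \<bullet> v j\<bar> powr p) sums s"
    using symmetric_atoms_of_functionals[where w = w and k = k, OF p k] by blast
  have a': "\<forall>j. a j \<ge> 0"
    using a less_imp_le by blast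
  have "ennreal (norm x powr p) = (\<integral>\<^sup>+ u. ennreal (\<bar>J x \<bullet> u\<bar> powr p) \<partial>symmetric_atoms a v)" for x
    unfolding nn_integral_inner_symmetric_atoms[OF v a']
    using av[OF sums] a' by (intro suminf_ennreal_eq[symmetric]) auto
  moreover have "bij J"
    by (rule bij_betw_byWitness[of _ K]) (auto simp: KJ JK)
  ultimately have "levy_representation p J (symmetric_atoms a v)"
    using J even_symmetric_atoms[OF v] by (simp add: levy_representation_def)
  moreover have "discrete_measure (symmetric_atoms a v)"
    using a v by (auto simp: discrete_measure_iff)
  ultimately show ?thesis
    unfolding has_discrete_levy_representation_def by blast
qed

theorem theorem2:
  fixes p :: real
  assumes "p > 0"
    and "\<exists>B :: 'a::real_normed_vector set. finite B \<and> span B = UNIV"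
    and "dim (UNIV :: 'a set) \<ge> 1"
    and "CARD('n::finite) = dim (UNIV :: 'a set)"
  shows "isometric_to_subspace_of_lp p TYPE('a) \<longleftrightarrow>
         has_discrete_levy_representation p TYPE('a) TYPE('n)"
proof
  assume "isometric_to_subspace_of_lp p TYPE('a)"
  then show "has_discrete_levy_representation p TYPE('a) TYPE('n)"
    using discrete_levy_representation_of_lp_isometry assms
    unfolding isometric_to_subspace_of_lp_def by blast
next
  assume "has_discrete_levy_representation p TYPE('a) TYPE('n)"
  then obtain J :: "'a \<Rightarrow> real ^ 'n" and \<xi>
    where levy: "levy_representation p J \<xi>" and "discrete_measure \<xi>"
    unfolding has_discrete_levy_representation_def by blast
  moreover have "sets \<xi> = sets sphere_borel"
    using levy by (simp add: levy_representation_def)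
  \<comment> \<open>The representing measure is now an explicit sum of atoms, from which the
    coordinates of the isometry are read off.\<close>
  ultimately obtain a v where "\<forall>j. a j > 0" "\<forall>j. v j \<in> sphere 0 1" "\<xi> = symmetric_atoms a v"
    by (auto simp: discrete_measure_iff)
  then show "isometric_to_subspace_of_lp p TYPE('a)"
    using lp_isometry_of_symmetric_atoms[OF assms(1)] levy
    unfolding isometric_to_subspace_of_lp_def by blast
qed

end
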